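(* Let $\mathrm{V}$ be a finite vertex set, let $\mathfrak{G}$ be the class of all undirected graphs over $\mathrm{V}$, and let $\mathcal{L}=(\mathfrak{G},\preceq)$ be the poset with $\mathcal{G}_1\preceq\mathcal{G}_2$ if and only if $\mathcal{M}^{\mathrm{o}}_{\mathrm{UG}}(\mathcal{G}_1)\subseteq\mathcal{M}^{\mathrm{o}}_{\mathrm{UG}}(\mathcal{G}_2)$. For undirected graphs $\mathcal{G}_1=(\mathrm{V},\mathrm{E}_1)$ and $\mathcal{G}_2=(\mathrm{V},\mathrm{E}_2)$, $$d_{\mathcal{L}}(\mathcal{G}_1,\mathcal{G}_2)=|\mathrm{E}_1\triangle\mathrm{E}_2|=\mathrm{SHD}_1(\mathcal{G}_1,\mathcal{G}_2).$$
   Context: Undirected graphs are simple (no loops, at most one edge per pair). $\triangle$ is symmetric difference. Model: for each $v\in\mathrm{V}$ let $\mathcal{X}_v$ be a measurable space with a $\sigma$-finite measure $\mu_v$ that is nondegenerate (there are two disjoint measurable sets of positive $\mu_v$-measure); $\mathcal{X}=\prod_v\mathcal{X}_v$, $\mu=\prod_v\mu_v$. $\mathcal{M}^{\mathrm{o}}_{+}$ is the set of probability laws $P$ of $X=(X_v)_{v\in\mathrm{V}}$ on $\mathcal{X}$ absolutely continuous with respect to $\mu$ with density $p>0$ $\mu$-a.e. $\mathcal{M}^{\mathrm{o}}_{\mathrm{UG}}(\mathcal{G})$ is the set of $P\in\mathcal{M}^{\mathrm{o}}_{+}$ such that for all disjoint $\mathrm{A},\mathrm{B},\mathrm{C}\subset\mathrm{V}$,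 if $\mathrm{C}$ separates $\mathrm{A}$ and $\mathrm{B}$ in $\mathcal{G}$, then $X_{\mathrm{A}}$ and $X_{\mathrm{B}}$ are conditionally independent given $X_{\mathrm{C}}$ under $P$. Distance: $x\lessdot y$ ($y$ covers $x$) if $x\prec y$ with nothing strictly between. $d_{\mathcal{L}}(\mathcal{G}_s,\mathcal{G}_t)$ is the minimum length $d$ of a sequence $\mathcal{G}_s=\mathcal{G}_0,\dots,\mathcal{G}_d=\mathcal{G}_t$ in which of any two consecutive graphs one covers the other. SHD: let $A_{i,j}=1$ if $i-j$ or $i\to j$ is in the graph and $A_{i,j}=0$ otherwise. With $A^s,A^t$ the matrices of $\mathcal{G}_s,\mathcal{G}_t$, $\mathrm{SHD}_1(\mathcal{G}_s,\mathcal{G}_t)=\sum_{i<j}\mathbb{I}[A^s_{i,j}\ne A^t_{i,j}\text{ or }A^s_{j,i}\ne A^t_{j,i}]$. *)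

theory Defs
  imports "HOL-Probability.Probability" "HOL-Library.Extended_Nat"
begin

section \<open>Undirected graphs and separation\<close>

text \<open>A simple undirected graph over \<^term>\<open>V\<close> is given by its edge set, a set of
  two-element subsets of \<^term>\<open>V\<close>; the vertex set is fixed throughout.\<close>

definition ugraphs :: "'v set \<Rightarrow> 'v set set set" where
  "ugraphs V = {E. E \<subseteq> {e. e \<subseteq> V \<and> card e = 2}}"

definition is_path :: "'v set \<Rightarrow> 'v set set \<Rightarrow> 'v list \<Rightarrow> bool" where
  "is_path V E xs \<longleftrightarrow>
     xs \<noteq> [] \<and> distinct xs \<and> set xs \<subseteq> V \<and> successively (\<lambda>u v. {u, v} \<in> E) xs"

definition separates :: "'v set \<Rightarrow> 'v set set \<Rightarrow> 'v set \<Rightarrow> 'v set \<Rightarrow> 'v set \<Rightarrow> bool" where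
  "separates V E C A B \<longleftrightarrow>
     (\<forall>xs. is_path V E xs \<and> hd xs \<in> A \<and> last xs \<in> B \<longrightarrow> set xs \<inter> C \<noteq> {})"


section \<open>Undirected graphical models\<close>

definition nondegenerate :: "'a measure \<Rightarrow> bool" where
  "nondegenerate N \<longleftrightarrow>
     (\<exists>S\<in>sets N. \<exists>T\<in>sets N. S \<inter> T = {} \<and> 0 < emeasure N S \<and> 0 < emeasure N T)"

text \<open>Conditional independence of \<^term>\<open>X\<close> and \<^term>\<open>Y\<close> given \<^term>\<open>Z\<close>, for random elements of
  arbitrary measurable spaces: conditional probabilities given \<^term>\<open>Z\<close> are conditional
  expectations of indicators with respect to the \<open>\<sigma>\<close>-algebra generated by \<^term>\<open>Z\<close>, so no
  regular conditional distributions are needed.\<close>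

definition cond_prob_given :: "'w measure \<Rightarrow> 'c measure \<Rightarrow> ('w \<Rightarrow> 'c) \<Rightarrow> 'w set \<Rightarrow> 'w \<Rightarrow> real" where
  "cond_prob_given P MZ Z S = real_cond_exp P (vimage_algebra (space P) Z MZ) (indicator S)"

definition cond_indep ::
  "'w measure \<Rightarrow> 'a measure \<Rightarrow> ('w \<Rightarrow> 'a) \<Rightarrow> 'b measure \<Rightarrow> ('w \<Rightarrow> 'b) \<Rightarrow> 'c measure \<Rightarrow> ('w \<Rightarrow> 'c) \<Rightarrow> bool"
where
  "cond_indep P MX X MY Y MZ Z \<longleftrightarrow>
     (\<forall>S\<in>sets MX. \<forall>T\<in>sets MY. AE w in P.
        cond_prob_given P MZ Z ((X -` S \<inter> space P) \<inter> (Y -` T \<inter> space P)) w =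
        cond_prob_given P MZ Z (X -` S \<inter> space P) w *
        cond_prob_given P MZ Z (Y -` T \<inter> space P) w)"

text \<open>A density of a probability measure with respect to a \<open>\<sigma>\<close>-finite measure is finite
  almost everywhere, so it may be taken real-valued.\<close>

definition positive_laws :: "'v set \<Rightarrow> ('v \<Rightarrow> 'a measure) \<Rightarrow> ('v \<Rightarrow> 'a) measure set" where
  "positive_laws V M =
     {P. prob_space P \<and>
         (\<exists>p :: ('v \<Rightarrow> 'a) \<Rightarrow> real. p \<in> borel_measurable (PiM V M) \<and>
            (AE x in PiM V M. 0 < p x) \<and>
            P = density (PiM V M) (\<lambda>x. ennreal (p x)))}"

text \<open>On \<^term>\<open>PiM V M\<close> the subvector of coordinates in \<^term>\<open>A\<close> is
  \<^term>\<open>\<lambda>x. restrict x A\<close>, with values in \<^term>\<open>PiM A M\<close>.\<close>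

definition ug_model :: "'v set \<Rightarrow> ('v \<Rightarrow> 'a measure) \<Rightarrow> 'v set set \<Rightarrow> ('v \<Rightarrow> 'a) measure set" where
  "ug_model V M E =
     {P \<in> positive_laws V M.
        \<forall>A B C. A \<subseteq> V \<and> B \<subseteq> V \<and> C \<subseteq> V \<and> A \<inter> B = {} \<and> A \<inter> C = {} \<and> B \<inter> C = {} \<and>
          separates V E C A B \<longrightarrow>
          cond_indep P (PiM A M) (\<lambda>x. restrict x A) (PiM B M) (\<lambda>x. restrict x B)
            (PiM C M) (\<lambda>x. restrict x C)}"

definition model_le :: "'v set \<Rightarrow> ('v \<Rightarrow> 'a measure) \<Rightarrow> 'v set set \<Rightarrow> 'v set set \<Rightarrow> bool" where
  "model_le V M E1 E2 \<longleftrightarrow> ug_model V M E1 \<subseteq> ug_model V M E2"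


section \<open>Distances\<close>

text \<open>\<^term>\<open>covered_by S le x y\<close> means that \<^term>\<open>y\<close> covers \<^term>\<open>x\<close> in the poset with
  carrier \<^term>\<open>S\<close> and order \<^term>\<open>le\<close>.\<close>

definition strictly_below :: "('g \<Rightarrow> 'g \<Rightarrow> bool) \<Rightarrow> 'g \<Rightarrow> 'g \<Rightarrow> bool" where
  "strictly_below le x y \<longleftrightarrow> le x y \<and> x \<noteq> y"

definition covered_by :: "'g set \<Rightarrow> ('g \<Rightarrow> 'g \<Rightarrow> bool) \<Rightarrow> 'g \<Rightarrow> 'g \<Rightarrow> bool" where
  "covered_by S le x y \<longleftrightarrow>
     x \<in> S \<and> y \<in> S \<and> strictly_below le x y \<and>
     \<not> (\<exists>z\<in>S. strictly_below le x z \<and> strictly_below le z y)"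

text \<open>The value is \<^term>\<open>\<infinity>\<close> if no connecting sequence exists; otherwise the infimum is attained.\<close>

definition poset_dist :: "'g set \<Rightarrow> ('g \<Rightarrow> 'g \<Rightarrow> bool) \<Rightarrow> 'g \<Rightarrow> 'g \<Rightarrow> enat" where
  "poset_dist S le s t =
     Inf {enat d | d. \<exists>g :: nat \<Rightarrow> 'g. g 0 = s \<and> g d = t \<and> (\<forall>i\<le>d. g i \<in> S) \<and>
       (\<forall>i<d. covered_by S le (g i) (g (Suc i)) \<or> covered_by S le (g (Suc i)) (g i))}"

text \<open>For undirected graphs there are no arrows \<open>i \<rightarrow> j\<close> to record in the adjacency matrix.\<close>

definition adj_matrix :: "'v set set \<Rightarrow> 'v \<Rightarrow> 'v \<Rightarrow> nat" where
  "adj_matrix E i j = (if {i, j} \<in> E then 1 else 0)"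

definition SHD1 :: "'v::linorder set \<Rightarrow> ('v \<Rightarrow> 'v \<Rightarrow> nat) \<Rightarrow> ('v \<Rightarrow> 'v \<Rightarrow> nat) \<Rightarrow> nat" where
  "SHD1 V A B =
     (\<Sum>(i, j)\<in>{(i, j). i \<in> V \<and> j \<in> V \<and> i < j}. of_bool (A i j \<noteq> B i j \<or> A j i \<noteq> B j i))"

end

theory Submission
  imports Defs
begin

text \<open>The order on graphs turns out to be inclusion of edge sets. Adding edges destroys separations,
  so the model grows. Conversely, let \<open>{a, b}\<close> be an edge of \<open>E1\<close> but not of \<open>E2\<close>, and mix two
  equivalent product laws that differ exactly in the factors at \<open>a\<close> and \<open>b\<close>. Under the mixture every
  subvector avoiding \<open>a\<close> and \<open>b\<close> is independent of all other coordinates, while \<open>X\<^sub>a\<close> and \<open>X\<^sub>b\<close> are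
  dependent. If \<open>C\<close> separates \<open>A\<close> and \<open>B\<close> in \<open>E1\<close>, one of \<open>A\<close>, \<open>B\<close> avoids both endpoints, and
  conditional independence follows; in \<open>E2\<close> the remaining vertices separate \<open>a\<close> from \<open>b\<close>, which would
  force \<open>X\<^sub>a\<close> and \<open>X\<^sub>b\<close> to be independent. In the Boolean lattice of edge sets a covering step changes
  exactly one edge, so the distance is the size of the symmetric difference.\<close>

section \<open>Conditional independence from independence\<close>

text \<open>A conditional expectation is characterised by its integrals over the sets of the
  sigma-algebra generated by \<open>Z\<close>. All of these are preimages under \<open>Z\<close>,
  and on them the constant \<open>prob T\<close> pulls out by \<open>factor\<close>.\<close>

lemma (in prob_space) cond_prob_given_factor:
  assumes Z: "Z \<in> measurable M MZ" and E: "E \<in> events" and T: "T \<in> events"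
    and factor: "\<And>U. U \<in> sets MZ \<Longrightarrow>
      prob (E \<inter> T \<inter> (Z -` U \<inter> space M)) = prob T * prob (E \<inter> (Z -` U \<inter> space M))"
  shows "AE w in M. cond_prob_given M MZ Z (E \<inter> T) w = prob T * cond_prob_given M MZ Z E w"
proof -
  let ?F = "vimage_algebra (space M) Z MZ"
  have sets_F: "sets ?F = {Z -` U \<inter> space M |U. U \<in> sets MZ}"
    using Z by (intro sets_vimage_algebra2) (auto simp: measurable_def)
  have "subalgebra M ?F"
    using Z by (auto simp: subalgebra_def sets_F)
  then interpret finite_measure_subalgebra M ?F
    by unfold_locales
  note [measurable] = E T
  have int: "integrable M (indicator A :: _ \<Rightarrow> real)" if "A \<in> events" for A
    using that by (intro integrable_real_indicator) (simp_all add: less_top[symmetric])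
  show ?thesis
    unfolding cond_prob_given_def
  proof (rule real_cond_exp_charact)
    fix U assume "U \<in> sets ?F"
    then obtain W where W: "W \<in> sets MZ" "U = Z -` W \<inter> space M"
      by (auto simp: sets_F)
    then have U: "U \<in> events"
      using Z by auto
    have "(\<integral>x\<in>U. indicat_real (E \<inter> T) x \<partial>M) = prob (E \<inter> T \<inter> U)"
      using U by (simp add: set_lebesgue_integral_def Int_commute flip: indicator_inter_arith)
    also have "\<dots> = prob T * prob (E \<inter> U)"
      using factor W by simp
    also have "prob (E \<inter> U) = (\<integral>x\<in>U. indicat_real E x \<partial>M)"
      using U by (simp add: set_lebesgue_integral_def Int_commute flip: indicator_inter_arith)
    also have "\<dots> = (\<integral>x\<in>U. real_cond_exp M ?F (indicat_real E) x \<partial>M)"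
      using int[OF E] \<open>U \<in> sets ?F\<close> by (rule real_cond_exp_intA)
    finally show "(\<integral>x\<in>U. indicat_real (E \<inter> T) x \<partial>M) =
        (\<integral>x\<in>U. prob T * real_cond_exp M ?F (indicat_real E) x \<partial>M)"
      by simp
  qed (use int E T in \<open>auto intro!: real_cond_exp_int integrable_mult_right\<close>)
qed

text \<open>The special case of the previous lemma in which the other event is the whole
  space.\<close>

lemma (in prob_space) cond_prob_given_indep:
  assumes Z: "Z \<in> measurable M MZ" and T: "T \<in> events"
    and indep: "\<And>U. U \<in> sets MZ \<Longrightarrow>
      prob (T \<inter> (Z -` U \<inter> space M)) = prob T * prob (Z -` U \<inter> space M)"
  shows "AE w in M. cond_prob_given M MZ Z T w = prob T"
proof -
  let ?F = "vimage_algebra (space M) Z MZ"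
  have "sets ?F = {Z -` U \<inter> space M |U. U \<in> sets MZ}"
    using Z by (intro sets_vimage_algebra2) (auto simp: measurable_def)
  then have "subalgebra M ?F"
    using Z by (auto simp: subalgebra_def)
  then interpret finite_measure_subalgebra M ?F
    by unfold_locales
  \<comment> \<open>The whole space lies in every sub-sigma-algebra, so its indicator is its own
    conditional expectation.\<close>
  have "AE w in M. cond_prob_given M MZ Z (space M) w = indicator (space M) w"
    unfolding cond_prob_given_def
    using sets.top[of ?F]
    by (intro real_cond_exp_F_meas borel_measurable_indicator integrable_real_indicator)
      (simp_all add: less_top[symmetric])
  moreover have "AE w in M. cond_prob_given M MZ Z (space M \<inter> T) w =
      prob T * cond_prob_given M MZ Z (space M) w"
    using T indep sets.sets_into_space[OF T]
    by (intro cond_prob_given_factor[OF Z]) (auto simp: Int_absorb1)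
  ultimately show ?thesis
    using sets.sets_into_space[OF T] by (auto elim: AE_mp simp: Int_absorb1)
qed

lemma cond_indep_sym:
  "cond_indep P MX X MY Y MZ Z \<Longrightarrow> cond_indep P MY Y MX X MZ Z"
  by (simp add: cond_indep_def Int_commute mult.commute)

text \<open>If \<open>Y\<close> is independent of the pair \<open>(X, Z)\<close>, tested on
  rectangles, then conditioning on \<open>Z\<close> leaves the probability of \<open>?T\<close>
  constant and this constant splits off from joint events.\<close>

lemma (in prob_space) cond_indepI_indep:
  assumes X: "X \<in> measurable M MX" and Y: "Y \<in> measurable M MY" and Z: "Z \<in> measurable M MZ"
    and factor: "\<And>S T U. \<lbrakk>S \<in> sets MX; T \<in> sets MY; U \<in> sets MZ\<rbrakk> \<Longrightarrow>
      prob ((X -` S \<inter> space M) \<inter> (Y -` T \<inter> space M) \<inter> (Z -` U \<inter> space M)) =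
      prob (Y -` T \<inter> space M) * prob ((X -` S \<inter> space M) \<inter> (Z -` U \<inter> space M))"
  shows "cond_indep M MX X MY Y MZ Z"
  unfolding cond_indep_def
proof (intro ballI)
  fix S T assume S: "S \<in> sets MX" and T: "T \<in> sets MY"
  let ?S = "X -` S \<inter> space M" and ?T = "Y -` T \<inter> space M"
  \<comment> \<open>Choosing the whole space for \<open>X\<close> in \<open>factor\<close> leaves
    the independence of \<open>Y\<close> and \<open>Z\<close>.\<close>
  have "X -` space MX \<inter> space M = space M"
    using X by (auto simp: measurable_def)
  then have "prob (?T \<inter> (Z -` U \<inter> space M)) = prob ?T * prob (Z -` U \<inter> space M)"
    if "U \<in> sets MZ" for U
    using factor[OF sets.top T that] by (simp add: Int_absorb1)
  then have "AE w in M. cond_prob_given M MZ Z ?T w = prob ?T"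
    using Y T by (intro cond_prob_given_indep[OF Z]) auto
  moreover have "AE w in M. cond_prob_given M MZ Z (?S \<inter> ?T) w =
      prob ?T * cond_prob_given M MZ Z ?S w"
    using X Y S T factor by (intro cond_prob_given_factor[OF Z]) auto
  ultimately show "AE w in M. cond_prob_given M MZ Z (?S \<inter> ?T) w =
      cond_prob_given M MZ Z ?S w * cond_prob_given M MZ Z ?T w"
    by eventually_elim simp
qed

text \<open>If \<open>Z\<close> is independent of the pair \<open>(X, Y)\<close>, all three
  conditional probabilities are constants, so conditional independence collapses to ordinary
  independence.\<close>

lemma (in prob_space) cond_indep_imp_prob_Int:
  assumes "cond_indep M MX X MY Y MZ Z"
    and X: "X \<in> measurable M MX" and Y: "Y \<in> measurable M MY" and Z: "Z \<in> measurable M MZ"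
    and S: "S \<in> sets MX" and T: "T \<in> sets MY"
    and indep: "\<And>S T U. \<lbrakk>S \<in> sets MX; T \<in> sets MY; U \<in> sets MZ\<rbrakk> \<Longrightarrow>
      prob ((X -` S \<inter> space M) \<inter> (Y -` T \<inter> space M) \<inter> (Z -` U \<inter> space M)) =
      prob ((X -` S \<inter> space M) \<inter> (Y -` T \<inter> space M)) * prob (Z -` U \<inter> space M)"
  shows "prob ((X -` S \<inter> space M) \<inter> (Y -` T \<inter> space M)) =
    prob (X -` S \<inter> space M) * prob (Y -` T \<inter> space M)"
proof -
  let ?S = "X -` S \<inter> space M" and ?T = "Y -` T \<inter> space M"
  have X': "X -` space MX \<inter> space M = space M" and Y': "Y -` space MY \<inter> space M = space M"
    using X Y by (auto simp: measurable_def)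
  have "AE w in M. cond_prob_given M MZ Z (?S \<inter> ?T) w = prob (?S \<inter> ?T)"
    using X Y S T indep by (intro cond_prob_given_indep[OF Z]) auto
  moreover have "AE w in M. cond_prob_given M MZ Z ?S w = prob ?S"
    using X S indep[OF S sets.top] Y' by (intro cond_prob_given_indep[OF Z]) (auto simp: Int_absorb2)
  moreover have "AE w in M. cond_prob_given M MZ Z ?T w = prob ?T"
    using Y T indep[OF sets.top T] X' by (intro cond_prob_given_indep[OF Z]) (auto simp: Int_absorb1)
  moreover have "AE w in M. cond_prob_given M MZ Z (?S \<inter> ?T) w =
      cond_prob_given M MZ Z ?S w * cond_prob_given M MZ Z ?T w"
    using assms(1) S T by (simp add: cond_indep_def)
  \<comment> \<open>The statement does not mention \<open>w\<close>, and a probability space is not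
    a null set.\<close>
  ultimately have "AE w in M. prob (?S \<inter> ?T) = prob ?S * prob ?T"
    by eventually_elim simp
  then show ?thesis
    by simp
qed

section \<open>Product measures\<close>

text \<open>A product measure is determined by its values on boxes, and on a box the integral of the
  product density splits into one-dimensional integrals.\<close>

lemma density_PiM:
  assumes V: "finite V" and M: "\<And>v. v \<in> V \<Longrightarrow> sigma_finite_measure (M v)"
    and f: "\<And>v. v \<in> V \<Longrightarrow> f v \<in> borel_measurable (M v)"
    and prob: "\<And>v. v \<in> V \<Longrightarrow> prob_space (density (M v) (f v))"
  shows "PiM V (\<lambda>v. density (M v) (f v)) = density (PiM V M) (\<lambda>x. \<Prod>v\<in>V. f v (x v))"
proof -
  \<comment> \<open>The locale of sigma-finite products quantifies over all indices, while the
    hypotheses cover only \<open>V\<close>; a point mass fills in elsewhere, and the product over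
    \<open>V\<close> does not see it.\<close>
  define M' where "M' v = (if v \<in> V then M v else return (count_space UNIV) undefined)" for v
  define N where "N v = (if v \<in> V then density (M v) (f v) else return (count_space UNIV) undefined)" for v
  have sf: "sigma_finite_measure (M' v)" "sigma_finite_measure (N v)" for v
    using M prob by (simp_all add: M'_def N_def prob_space_imp_sigma_finite prob_space_return)
  interpret M': product_sigma_finite M'
    by (rule product_sigma_finite.intro) (rule sf)
  interpret N: product_sigma_finite N
    by (rule product_sigma_finite.intro) (rule sf)
  have eqs: "PiM V M = PiM V M'" "PiM V (\<lambda>v. density (M v) (f v)) = PiM V N"
    by (auto intro!: PiM_cong simp: M'_def N_def)
  have fm: "(\<lambda>x. f v (x v)) \<in> borel_measurable (PiM V M')" if "v \<in> V" for v
    using measurable_compose[OF measurable_component_singleton[OF that, of M'], of "f v" borel] f[OF that] that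
    by (simp add: M'_def)
  have "density (PiM V M') (\<lambda>x. \<Prod>v\<in>V. f v (x v)) = PiM V N"
  proof (rule N.PiM_eqI[OF V])
    show "sets (density (PiM V M') (\<lambda>x. \<Prod>v\<in>V. f v (x v))) = sets (PiM V N)"
      by (auto intro!: sets_PiM_cong simp: M'_def N_def)
    fix A assume A: "\<And>v. v \<in> V \<Longrightarrow> A v \<in> sets (N v)"
    then have A': "A v \<in> sets (M v)" if "v \<in> V" for v
      using that by (force simp: N_def)
    have "emeasure (density (PiM V M') (\<lambda>x. \<Prod>v\<in>V. f v (x v))) (Pi\<^sub>E V A) =
        (\<integral>\<^sup>+x. (\<Prod>v\<in>V. f v (x v)) * indicator (Pi\<^sub>E V A) x \<partial>PiM V M')"
      using fm A' V by (intro emeasure_density) (auto intro!: borel_measurable_prod_ennreal sets_PiM_I_finite simp: M'_def)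
    also have "\<dots> = (\<integral>\<^sup>+x. (\<Prod>v\<in>V. f v (x v) * indicator (A v) (x v)) \<partial>PiM V M')"
    proof (rule nn_integral_cong)
      fix x assume "x \<in> space (PiM V M')"
      \<comment> \<open>Membership in a box includes extensionality; with this known, the indicator
        of the box is the product of the coordinate indicators.\<close>
      then have "x \<in> extensional V"
        by (auto simp: space_PiM PiE_def)
      then have "indicator (Pi\<^sub>E V A) x = (\<Prod>v\<in>V. indicator (A v) (x v) :: ennreal)"
        using V by (auto simp: indicator_def PiE_iff prod.If_cases prod_zero_iff)
      then show "(\<Prod>v\<in>V. f v (x v)) * indicator (Pi\<^sub>E V A) x =
          (\<Prod>v\<in>V. f v (x v) * indicator (A v) (x v))"
        by (simp add: prod.distrib)
    qed
    also have "\<dots> = (\<Prod>v\<in>V. \<integral>\<^sup>+x. f v x * indicator (A v) x \<partial>M' v)"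
      using f A' by (intro M'.product_nn_integral_prod V) (auto simp: M'_def)
    also have "\<dots> = (\<Prod>v\<in>V. emeasure (N v) (A v))"
      using f A' by (intro prod.cong) (auto simp: M'_def N_def emeasure_density)
    finally show "emeasure (density (PiM V M') (\<lambda>x. \<Prod>v\<in>V. f v (x v))) (Pi\<^sub>E V A) =
        (\<Prod>v\<in>V. emeasure (N v) (A v))" .
  qed
  then show ?thesis
    by (simp add: eqs)
qed

text \<open>Sigma-finiteness provides a strictly positive integrable \<open>h\<close>; rescaling it
  by separate constants on \<open>S\<close> and on its complement gives these sets mass
  \<open>r\<close> and \<open>1 - r\<close>.\<close>

lemma positive_density_prescribed_mass:
  assumes "sigma_finite_measure M" "S \<in> sets M" "0 < emeasure M S" "0 < emeasure M (space M - S)"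
    and r: "0 < r" "r < 1"
  obtains f :: "'a \<Rightarrow> real" where "f \<in> borel_measurable M" "\<And>x. 0 < f x"
    "prob_space (density M f)" "measure (density M f) S = r"
proof -
  interpret sigma_finite_measure M by fact
  obtain h :: "'a \<Rightarrow> real" where h[measurable]: "h \<in> borel_measurable M" and pos: "\<And>x. 0 < h x"
    and int: "integrable M h"
    using obtain_positive_integrable_function by metis
  note [measurable] = \<open>S \<in> sets M\<close>
  \<comment> \<open>If the integral vanished, so would the strictly positive \<open>h\<close> almost
    everywhere on \<open>A\<close>, making \<open>A\<close> a null set.\<close>
  have mass: "0 < (\<integral>x\<in>A. h x \<partial>M)" if "A \<in> sets M" "0 < emeasure M A" for A
  proof -
    have "set_integrable M A h"
      using integrable_mult_indicator[OF that(1) int] by (simp add: set_integrable_def)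
    moreover have "\<not> (AE x in M. indicator A x * h x = 0)"
    proof
      assume "AE x in M. indicator A x * h x = 0"
      then have "AE x in M. x \<notin> A"
        by eventually_elim (use pos in \<open>auto simp: indicator_def less_le split: if_splits\<close>)
      then show False
        using that AE_iff_null_sets[of A M] by auto
    qed
    ultimately show ?thesis
      using pos integral_nonneg_eq_0_iff_AE[of M "\<lambda>x. indicator A x * h x"]
        integral_nonneg_AE[of "\<lambda>x. indicator A x * h x" M]
      by (auto simp: set_lebesgue_integral_def set_integrable_def less_le intro!: mult_nonneg_nonneg)
  qed
  define s t where "s = (\<integral>x\<in>S. h x \<partial>M)" and "t = (\<integral>x\<in>space M - S. h x \<partial>M)"
  have st: "0 < s" "0 < t"
    using mass assms by (auto simp: s_def t_def)
  define f where "f x = h x * (if x \<in> S then r / s else (1 - r) / t)" for x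
  have f[measurable]: "f \<in> borel_measurable M"
    unfolding f_def by measurable
  have f_pos: "0 < f x" for x
    using pos st r by (simp add: f_def)
  have nn: "emeasure (density M f) A = ennreal (c * (\<integral>x\<in>A. h x \<partial>M))"
    if A: "A \<in> sets M" and c: "0 \<le> c" "\<And>x. x \<in> A \<Longrightarrow> f x = c * h x" for A c
  proof -
    have i: "integrable M (\<lambda>x. c * (indicator A x * h x))"
      using integrable_mult_indicator[OF A int] by (intro integrable_mult_right) simp
    have "emeasure (density M f) A = (\<integral>\<^sup>+x. ennreal (c * (indicator A x * h x)) \<partial>M)"
      using A c by (subst emeasure_density) (auto intro!: nn_integral_cong simp: indicator_def)
    also have "\<dots> = ennreal (c * (\<integral>x\<in>A. h x \<partial>M))"
      using i pos c by (subst nn_integral_eq_integral)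
        (auto simp: set_lebesgue_integral_def less_imp_le intro!: AE_I2 mult_nonneg_nonneg)
    finally show ?thesis .
  qed
  have S: "emeasure (density M f) S = ennreal r"
    using nn[of S "r / s"] st r by (simp add: f_def s_def)
  moreover have "emeasure (density M f) (space M - S) = ennreal (1 - r)"
    using nn[of "space M - S" "(1 - r) / t"] st r by (simp add: f_def t_def)
  ultimately have "emeasure (density M f) (space M) = ennreal r + ennreal (1 - r)"
    using plus_emeasure[of S "density M f" "space M - S"] sets.sets_into_space[OF assms(2)]
    by (simp add: Un_absorb1 Un_Diff_cancel)
  also have "\<dots> = 1"
    using r by (simp flip: ennreal_plus)
  finally have "prob_space (density M f)"
    by (intro prob_spaceI) simp
  then show thesis
    using that[OF f f_pos] S r by (simp add: measure_def)
qed

text \<open>Under a product law the coordinates are independent because the joint law is the product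
  of its marginals; hence so are subvectors over disjoint index blocks.\<close>

lemma (in product_prob_space) measure_prod_emb_Int:
  assumes "finite I" "I \<noteq> {}" "A \<subseteq> I" "B \<subseteq> I" "A \<inter> B = {}"
    and S: "S \<in> sets (PiM A M)" and T: "T \<in> sets (PiM B M)"
  shows "measure (PiM I M) (prod_emb I M A S \<inter> prod_emb I M B T) =
    measure (PiM I M) (prod_emb I M A S) * measure (PiM I M) (prod_emb I M B T)"
proof -
  have "distr (PiM I M) (PiM I M) (\<lambda>x. restrict x I) = PiM I M"
    using assms(1) by (intro distr_restrict[symmetric]) auto
  moreover have "PiM I (\<lambda>v. distr (PiM I M) (M v) (\<lambda>x. x v)) = PiM I M"
    by (intro PiM_cong refl distr_PiM_component prob_space)
  ultimately have "P.indep_vars M (\<lambda>v x. x v) I"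
    using \<open>I \<noteq> {}\<close> by (subst P.indep_vars_iff_distr_eq_PiM') auto
  then have "P.indep_var (PiM A M) (\<lambda>x. restrict x A) (PiM B M) (\<lambda>x. restrict x B)"
    using P.indep_var_restrict[of M "\<lambda>v x. x v" I A B] assms by simp
  from P.indep_varD[OF this S T] show ?thesis
    by (simp add: prod_emb_def space_PiM vimage_def Int_def conj_ac)
qed

text \<open>Independence survives mixing when one of the two events has the same probability
  \<open>q\<close> under both components: the average of \<open>q * u\<close> and
  \<open>q * w\<close> is \<open>q\<close> times that of \<open>u\<close> and \<open>w\<close>. At
  \<open>a\<close> and \<open>b\<close> both probabilities move with the component, which creates a
  covariance.\<close>

lemma dependent_pair_law:
  fixes M :: "'v \<Rightarrow> 'a measure"
  assumes V: "finite V" and sf: "\<And>v. v \<in> V \<Longrightarrow> sigma_finite_measure (M v)"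
    and nd: "\<And>v. v \<in> V \<Longrightarrow> nondegenerate (M v)"
    and ab: "a \<in> V" "b \<in> V" "a \<noteq> b"
  obtains P S T where "P \<in> positive_laws V M" "S \<in> sets (PiM {a} M)" "T \<in> sets (PiM {b} M)"
    "measure P (prod_emb V M {a} S \<inter> prod_emb V M {b} T) \<noteq>
      measure P (prod_emb V M {a} S) * measure P (prod_emb V M {b} T)"
    "\<And>B D T W. \<lbrakk>B \<subseteq> V - {a, b}; D \<subseteq> V; B \<inter> D = {}; T \<in> sets (PiM B M); W \<in> sets (PiM D M)\<rbrakk> \<Longrightarrow>
      measure P (prod_emb V M B T \<inter> prod_emb V M D W) =
      measure P (prod_emb V M B T) * measure P (prod_emb V M D W)"
proof -
  have "\<exists>S f g. S \<in> sets (M v) \<and>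
      f \<in> borel_measurable (M v) \<and> (\<forall>x. 0 < f x) \<and> prob_space (density (M v) (\<lambda>x. ennreal (f x))) \<and>
      measure (density (M v) f) S = 1/2 \<and>
      g \<in> borel_measurable (M v) \<and> (\<forall>x. 0 < g x) \<and> prob_space (density (M v) (\<lambda>x. ennreal (g x))) \<and>
      measure (density (M v) g) S = 1/3" (is "\<exists>S f g. ?Q v S f g") if v: "v \<in> V" for v
  proof -
    obtain S T where S: "S \<in> sets (M v)" "0 < emeasure (M v) S"
      and T: "T \<in> sets (M v)" "S \<inter> T = {}" "0 < emeasure (M v) T"
      using nd[OF v] by (auto simp: nondegenerate_def)
    \<comment> \<open>Nondegeneracy gives two disjoint sets of positive measure; the second makes
      the complement of the first positive, as prescribing masses requires.\<close>
    have "emeasure (M v) T \<le> emeasure (M v) (space (M v) - S)"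
      using S T sets.sets_into_space[OF T(1)] by (intro emeasure_mono) auto
    then have S': "0 < emeasure (M v) (space (M v) - S)"
      using T by simp
    obtain f where "f \<in> borel_measurable (M v)" "\<And>x. 0 < f x"
      "prob_space (density (M v) (\<lambda>x. ennreal (f x)))" "measure (density (M v) f) S = 1/2"
      using positive_density_prescribed_mass[OF sf[OF v] S S', of "1/2"] by auto
    moreover obtain g where "g \<in> borel_measurable (M v)" "\<And>x. 0 < g x"
      "prob_space (density (M v) (\<lambda>x. ennreal (g x)))" "measure (density (M v) g) S = 1/3"
      using positive_density_prescribed_mass[OF sf[OF v] S S', of "1/3"] by auto
    ultimately show ?thesis
      using S by blast
  qed
  then obtain S f g where Sfg: "\<And>v. v \<in> V \<Longrightarrow> ?Q v (S v) (f v) (g v)"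
    by metis
  define h where "h v = (if v \<in> {a, b} then g v else f v)" for v
  have h: "h v \<in> borel_measurable (M v)" "\<And>x. 0 < h v x"
    "prob_space (density (M v) (\<lambda>x. ennreal (h v x)))" if "v \<in> V" for v
    using Sfg[OF that] by (auto simp: h_def)
  \<comment> \<open>Again a point mass outside \<open>V\<close>, so that every factor is a
    probability space.\<close>
  define N :: "('v \<Rightarrow> 'a \<Rightarrow> real) \<Rightarrow> 'v \<Rightarrow> 'a measure" where
    "N k v = (if v \<in> V then density (M v) (k v) else return (count_space UNIV) undefined)" for k v
  define F :: "('v \<Rightarrow> 'a \<Rightarrow> real) \<Rightarrow> ('v \<Rightarrow> 'a) \<Rightarrow> real" where "F k x = (\<Prod>v\<in>V. k v (x v))" for k x
  have N_ppr: "product_prob_space (N k)"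
    if "\<And>v. v \<in> V \<Longrightarrow> prob_space (density (M v) (\<lambda>x. ennreal (k v x)))" for k
    using that by (intro product_prob_spaceI) (simp add: N_def prob_space_return)
  interpret f: product_prob_space "N f" V
    using Sfg by (intro N_ppr) auto
  interpret h: product_prob_space "N h" V
    using h by (intro N_ppr) auto
  have sets_N: "sets (PiM A (N k)) = sets (PiM A M)" if "A \<subseteq> V" for A k
    using that by (intro sets_PiM_cong) (auto simp: N_def)
  have emb_N: "prod_emb V (N k) A S = prod_emb V M A S" for A k S
    unfolding prod_emb_def by (intro arg_cong2[where f = "(\<inter>)"] PiE_cong refl) (simp add: N_def)
  have N_density: "PiM V (N k) = density (PiM V M) (\<lambda>x. ennreal (F k x))"
    if "\<And>v. v \<in> V \<Longrightarrow> k v \<in> borel_measurable (M v)" "\<And>v x. v \<in> V \<Longrightarrow> 0 < k v x"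
      "\<And>v. v \<in> V \<Longrightarrow> prob_space (density (M v) (\<lambda>x. ennreal (k v x)))" for k
  proof -
    have "PiM V (N k) = PiM V (\<lambda>v. density (M v) (k v))"
      by (intro PiM_cong) (auto simp: N_def)
    also have "\<dots> = density (PiM V M) (\<lambda>x. \<Prod>v\<in>V. ennreal (k v (x v)))"
      using that by (intro density_PiM V sf) auto
    also have "(\<lambda>x. \<Prod>v\<in>V. ennreal (k v (x v))) = (\<lambda>x. ennreal (F k x))"
      using that(2) by (auto simp: F_def prod_ennreal less_imp_le)
    finally show ?thesis .
  qed
  have F_meas: "F k \<in> borel_measurable (PiM V M)" if "\<And>v. v \<in> V \<Longrightarrow> k v \<in> borel_measurable (M v)" for k
    unfolding F_def
    by (intro borel_measurable_prod measurable_compose[OF measurable_component_singleton] that)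
  have F_pos: "0 < F k x" if "\<And>v x. v \<in> V \<Longrightarrow> 0 < k v x" for k x
    unfolding F_def using that by (intro prod_pos) auto
  text \<open>The law is the even mixture of two product laws that differ only in the factors at
    \<^term>\<open>a\<close> and \<^term>\<open>b\<close>: mixing correlates these two coordinates and nothing else.\<close>
  define c :: real where "c = 1 / 2"
  have c: "0 \<le> c"
    by (simp add: c_def)
  define p where "p x = c * (F f x + F h x)" for x
  define P where "P = density (PiM V M) (\<lambda>x. ennreal (p x))"
  have [measurable]: "F f \<in> borel_measurable (PiM V M)" "F h \<in> borel_measurable (PiM V M)"
    using Sfg h by (auto intro: F_meas)
  have pos: "0 < F f x" "0 < F h x" for x
    using Sfg h by (auto intro: F_pos)
  have p[measurable]: "p \<in> borel_measurable (PiM V M)"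
    unfolding p_def by measurable
  have p_pos: "0 < p x" for x
    using pos[of x] by (simp add: p_def c_def)
  \<comment> \<open>The mixture of densities is a mixture of measures, so \<open>P\<close> inherits
    product formulas from its two components.\<close>
  have P_eq: "emeasure P E = ennreal c * (emeasure (PiM V (N f)) E + emeasure (PiM V (N h)) E)"
    if [measurable]: "E \<in> sets (PiM V M)" for E
  proof -
    have "emeasure P E =
        (\<integral>\<^sup>+x. ennreal c * (ennreal (F f x) * indicator E x + ennreal (F h x) * indicator E x) \<partial>PiM V M)"
      unfolding P_def using pos c
      by (subst emeasure_density)
        (auto intro!: nn_integral_cong simp: p_def indicator_def less_imp_le
          simp flip: ennreal_plus ennreal_mult)
    also have "\<dots> = ennreal c *
        ((\<integral>\<^sup>+x. ennreal (F f x) * indicator E x \<partial>PiM V M) + (\<integral>\<^sup>+x. ennreal (F h x) * indicator E x \<partial>PiM V M))"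
      by (simp add: nn_integral_cmult nn_integral_add)
    also have "\<dots> = ennreal c * (emeasure (PiM V (N f)) E + emeasure (PiM V (N h)) E)"
      using Sfg h by (simp add: N_density emeasure_density)
    finally show ?thesis .
  qed
  have P_meas: "measure P E = c * (measure (PiM V (N f)) E + measure (PiM V (N h)) E)"
    if "E \<in> sets (PiM V M)" for E
    using P_eq[OF that] unfolding f.P.emeasure_eq_measure h.P.emeasure_eq_measure
    using c by (simp add: measure_def[of P] flip: ennreal_plus ennreal_mult)
  have space_P: "space P = space (PiM V M)"
    by (simp add: P_def)
  have "space (PiM V (N k)) = space (PiM V M)" for k
    using sets_N[of V k] by (intro sets_eq_imp_space_eq) simp
  moreover have "ennreal c * 2 = 1"
  proof -
    have "ennreal c * ennreal 2 = ennreal (c * 2)"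
      using c by (intro ennreal_mult[symmetric]) simp_all
    also have "c * 2 = 1"
      by (simp add: c_def)
    finally show ?thesis
      by simp
  qed
  ultimately have "emeasure P (space P) = 1"
    using P_eq[of "space P"] f.P.emeasure_space_1 h.P.emeasure_space_1 by (simp add: space_P)
  then have "P \<in> positive_laws V M"
    using p p_pos by (auto simp: positive_laws_def P_def intro!: prob_spaceI exI[of _ p])
  moreover have S': "Pi\<^sub>E {v} S \<in> sets (PiM {v} M)" if "v \<in> V" for v
    using Sfg that by (intro sets_PiM_I_finite) auto
  have emb: "prod_emb V M A W \<in> sets (PiM V M)" if "A \<subseteq> V" "W \<in> sets (PiM A M)" for A W
    using that by (rule measurable_prod_emb)
  have f_Int: "measure (PiM V (N f)) (prod_emb V M A U \<inter> prod_emb V M B W) =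
      measure (PiM V (N f)) (prod_emb V M A U) * measure (PiM V (N f)) (prod_emb V M B W)"
    if "A \<subseteq> V" "B \<subseteq> V" "A \<inter> B = {}" "U \<in> sets (PiM A M)" "W \<in> sets (PiM B M)" for A B U W
    using f.measure_prod_emb_Int[of A B U W] that V ab by (auto simp: emb_N sets_N)
  have h_Int: "measure (PiM V (N h)) (prod_emb V M A U \<inter> prod_emb V M B W) =
      measure (PiM V (N h)) (prod_emb V M A U) * measure (PiM V (N h)) (prod_emb V M B W)"
    if "A \<subseteq> V" "B \<subseteq> V" "A \<inter> B = {}" "U \<in> sets (PiM A M)" "W \<in> sets (PiM B M)" for A B U W
    using h.measure_prod_emb_Int[of A B U W] that V ab by (auto simp: emb_N sets_N)
  have f_S: "measure (PiM V (N f)) (prod_emb V M {v} (Pi\<^sub>E {v} S)) = 1/2" if "v \<in> V" for v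
    using f.measure_PiM_emb[of "{v}" S] Sfg[OF that] that by (simp add: emb_N N_def)
  have h_S: "measure (PiM V (N h)) (prod_emb V M {v} (Pi\<^sub>E {v} S)) = 1/3" if "v \<in> {a, b}" for v
    using h.measure_PiM_emb[of "{v}" S] Sfg[of v] that ab by (auto simp: emb_N N_def h_def)
  \<comment> \<open>With masses 1/2 and 1/3 in the two components, the left side is (1/4 + 1/9)/2 =
    26/144 and the right side is (5/12)^2 = 25/144.\<close>
  have "measure P (prod_emb V M {a} (Pi\<^sub>E {a} S) \<inter> prod_emb V M {b} (Pi\<^sub>E {b} S)) \<noteq>
      measure P (prod_emb V M {a} (Pi\<^sub>E {a} S)) * measure P (prod_emb V M {b} (Pi\<^sub>E {b} S))"
    using ab by (simp add: P_meas emb S' sets.Int f_Int h_Int f_S h_S c_def)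
  moreover have "measure P (prod_emb V M B T \<inter> prod_emb V M D W) =
      measure P (prod_emb V M B T) * measure P (prod_emb V M D W)"
    if BD: "B \<subseteq> V - {a, b}" "D \<subseteq> V" "B \<inter> D = {}" "T \<in> sets (PiM B M)" "W \<in> sets (PiM D M)" for B D T W
  proof -
    have "B \<subseteq> V" "finite B"
      using BD V by (auto intro: finite_subset[of B V])
    \<comment> \<open>The components agree on the factors in \<open>B\<close>, so the event over
      \<open>B\<close> has the same probability in both and factors out of the mixture.\<close>
    have "PiM B (N f) = PiM B (N h)"
      using BD by (intro PiM_cong) (auto simp: N_def h_def)
    then have "measure (PiM V (N f)) (prod_emb V M B T) = measure (PiM V (N h)) (prod_emb V M B T)"
      using f.emeasure_PiM_emb'[of B T] h.emeasure_PiM_emb'[of B T] BD \<open>B \<subseteq> V\<close> \<open>finite B\<close>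
      by (simp add: emb_N sets_N measure_def)
    then show ?thesis
      using BD \<open>B \<subseteq> V\<close> by (simp add: P_meas emb sets.Int f_Int h_Int c_def field_simps)
  qed
  ultimately show thesis
    using that S' ab by metis
qed

section \<open>The model order\<close>

lemma separates_mono:
  assumes "separates V E2 C A B" "E1 \<subseteq> E2"
  shows "separates V E1 C A B"
proof -
  have "is_path V E2 xs" if "is_path V E1 xs" for xs
    using that assms(2) successively_mono[of "\<lambda>u v. {u, v} \<in> E1" xs "\<lambda>u v. {u, v} \<in> E2"]
    by (auto simp: is_path_def)
  then show ?thesis
    using assms(1) by (simp add: separates_def)
qed

lemma separates_nonadjacent:
  assumes "{a, b} \<notin> E" "a \<noteq> b"
  shows "separates V E (V - {a, b}) {a} {b}"
  unfolding separates_def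
proof (intro allI impI notI)
  fix xs assume xs: "is_path V E xs \<and> hd xs \<in> {a} \<and> last xs \<in> {b}" and "set xs \<inter> (V - {a, b}) = {}"
  then have "set xs \<subseteq> {a, b}"
    by (auto simp: is_path_def)
  then show False
    \<comment> \<open>Split by length: one vertex would force \<open>a = b\<close>, two vertices
      would use the missing edge, and three distinct vertices do not fit into
      \<open>{a, b}\<close>.\<close>
    using xs assms by (cases xs; cases "tl xs"; cases "tl (tl xs)") (auto simp: is_path_def split: if_splits)
qed

text \<open>An edge from \<open>A\<close> to \<open>B\<close> would itself be a path avoiding
  \<open>C\<close>.\<close>

lemma separates_no_edge_across:
  assumes "separates V E C A B" "A \<subseteq> V" "B \<subseteq> V" "A \<inter> B = {}" "A \<inter> C = {}" "B \<inter> C = {}"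
    and "a \<in> A" "b \<in> B"
  shows "{a, b} \<notin> E"
proof
  assume "{a, b} \<in> E"
  then have "is_path V E [a, b]"
    using assms by (auto simp: is_path_def)
  then have "set [a, b] \<inter> C \<noteq> {}"
    using assms unfolding separates_def by fastforce
  then show False
    using assms by auto
qed

section \<open>Comparison of graphical models\<close>

lemma ug_modelD:
  assumes "P \<in> ug_model V M E" "separates V E C A B"
    and "A \<subseteq> V" "B \<subseteq> V" "C \<subseteq> V" "A \<inter> B = {}" "A \<inter> C = {}" "B \<inter> C = {}"
  shows "cond_indep P (PiM A M) (\<lambda>x. restrict x A) (PiM B M) (\<lambda>x. restrict x B)
    (PiM C M) (\<lambda>x. restrict x C)"
  using assms unfolding ug_model_def by simp

lemma ug_modelI:
  assumes "P \<in> positive_laws V M"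
    and "\<And>A B C. \<lbrakk>separates V E C A B; A \<subseteq> V; B \<subseteq> V; C \<subseteq> V; A \<inter> B = {}; A \<inter> C = {}; B \<inter> C = {}\<rbrakk> \<Longrightarrow>
      cond_indep P (PiM A M) (\<lambda>x. restrict x A) (PiM B M) (\<lambda>x. restrict x B)
        (PiM C M) (\<lambda>x. restrict x C)"
  shows "P \<in> ug_model V M E"
  using assms unfolding ug_model_def by simp

text \<open>This removes the measures from the problem: what remains is the combinatorics of edge
  sets ordered by inclusion.\<close>

lemma model_le_iff_subset:
  fixes M :: "'v \<Rightarrow> 'a measure"
  assumes V: "finite V" and sf: "\<And>v. v \<in> V \<Longrightarrow> sigma_finite_measure (M v)"
    and nd: "\<And>v. v \<in> V \<Longrightarrow> nondegenerate (M v)"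
    and E1: "E1 \<in> ugraphs V"
  shows "model_le V M E1 E2 \<longleftrightarrow> E1 \<subseteq> E2"
proof
  assume sub: "E1 \<subseteq> E2"
  show "model_le V M E1 E2"
    unfolding model_le_def
  proof
    fix P assume P: "P \<in> ug_model V M E1"
    then have "P \<in> positive_laws V M"
      by (simp add: ug_model_def)
    \<comment> \<open>Separation in the larger graph implies separation in the smaller one, so every
      independence demanded by \<open>E2\<close> is already demanded by \<open>E1\<close>.\<close>
    then show "P \<in> ug_model V M E2"
      by (rule ug_modelI) (rule ug_modelD[OF P separates_mono[OF _ sub]])
  qed
next
  assume le: "model_le V M E1 E2"
  show "E1 \<subseteq> E2"
  proof (rule ccontr)
    assume "\<not> E1 \<subseteq> E2"
    then obtain e where e: "e \<in> E1" "e \<notin> E2"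
      by blast
    then have "e \<subseteq> V" "card e = 2"
      using E1 by (auto simp: ugraphs_def)
    then obtain a b where e_eq: "e = {a, b}" and ab: "a \<noteq> b" "a \<in> V" "b \<in> V"
      by (auto simp: card_2_iff)
    obtain P S T where P: "P \<in> positive_laws V M" and S: "S \<in> sets (PiM {a} M)" and T: "T \<in> sets (PiM {b} M)"
      and dep: "measure P (prod_emb V M {a} S \<inter> prod_emb V M {b} T) \<noteq>
        measure P (prod_emb V M {a} S) * measure P (prod_emb V M {b} T)"
      and indep: "\<And>B D T W. \<lbrakk>B \<subseteq> V - {a, b}; D \<subseteq> V; B \<inter> D = {}; T \<in> sets (PiM B M); W \<in> sets (PiM D M)\<rbrakk> \<Longrightarrow>
        measure P (prod_emb V M B T \<inter> prod_emb V M D W) =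
        measure P (prod_emb V M B T) * measure P (prod_emb V M D W)"
      by (rule dependent_pair_law[OF V _ _ ab(2,3,1), of M]) (erule sf, erule nd, rule that)
    interpret prob_space P
      using P by (simp add: positive_laws_def)
    have sets_P: "sets P = sets (PiM V M)"
      using P by (auto simp: positive_laws_def)
    have emb: "(\<lambda>x. restrict x A) -` S \<inter> space P = prod_emb V M A S" for A S
      using sets_eq_imp_space_eq[OF sets_P] by (simp add: prod_emb_def space_PiM)
    have meas: "(\<lambda>x. restrict x A) \<in> measurable P (PiM A M)" if "A \<subseteq> V" for A
      using measurable_restrict_subset[OF that] by (simp add: measurable_cong_sets[OF sets_P refl])
    \<comment> \<open>\<open>indep\<close> speaks of two blocks only, so two of the three cylinder
      events are merged into one over the union of their index sets.\<close>
    have join: "\<exists>W\<in>sets (PiM (A \<union> C) M). prod_emb V M A S \<inter> prod_emb V M C U = prod_emb V M (A \<union> C) W"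
      if "A \<subseteq> V" "C \<subseteq> V" "S \<in> sets (PiM A M)" "U \<in> sets (PiM C M)" for A C S U
    proof
      show "prod_emb (A \<union> C) M A S \<inter> prod_emb (A \<union> C) M C U \<in> sets (PiM (A \<union> C) M)"
        using that by (intro sets.Int measurable_prod_emb) auto
      show "prod_emb V M A S \<inter> prod_emb V M C U =
          prod_emb V M (A \<union> C) (prod_emb (A \<union> C) M A S \<inter> prod_emb (A \<union> C) M C U)"
        using that by (simp add: prod_emb_Int)
    qed
    let ?ci = "\<lambda>A B C. cond_indep P (PiM A M) (\<lambda>x. restrict x A) (PiM B M) (\<lambda>x. restrict x B)
      (PiM C M) (\<lambda>x. restrict x C)"
    \<comment> \<open>A block \<open>B\<close> avoiding \<open>a\<close> and \<open>b\<close> is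
      independent of all other coordinates jointly, in particular of those in \<open>A\<close> and
      \<open>C\<close> together.\<close>
    have ci: "?ci A B C"
      if ABC: "A \<subseteq> V" "B \<subseteq> V - {a, b}" "C \<subseteq> V" "A \<inter> B = {}" "B \<inter> C = {}" for A B C
    proof (rule cond_indepI_indep)
      fix S T U assume S: "S \<in> sets (PiM A M)" and T: "T \<in> sets (PiM B M)" and U: "U \<in> sets (PiM C M)"
      obtain W where W: "W \<in> sets (PiM (A \<union> C) M)"
        "prod_emb V M A S \<inter> prod_emb V M C U = prod_emb V M (A \<union> C) W"
        using join[OF ABC(1,3) S U] by blast
      have "prob (prod_emb V M B T \<inter> (prod_emb V M A S \<inter> prod_emb V M C U)) =
          prob (prod_emb V M B T) * prob (prod_emb V M A S \<inter> prod_emb V M C U)"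
        unfolding W(2) using ABC T W(1) by (intro indep) auto
      then show "prob (((\<lambda>x. restrict x A) -` S \<inter> space P) \<inter> ((\<lambda>x. restrict x B) -` T \<inter> space P) \<inter>
            ((\<lambda>x. restrict x C) -` U \<inter> space P)) =
          prob ((\<lambda>x. restrict x B) -` T \<inter> space P) *
          prob (((\<lambda>x. restrict x A) -` S \<inter> space P) \<inter> ((\<lambda>x. restrict x C) -` U \<inter> space P))"
        unfolding emb by (simp only: Int_ac)
    qed (use ABC in \<open>auto intro: meas\<close>)
    have edge: "{a, b} \<in> E1" "{b, a} \<in> E1" "{a, b} \<notin> E2"
      using e e_eq by (simp_all add: insert_commute)
    have "P \<in> ug_model V M E1"
      using P
    proof (rule ug_modelI)
      fix A B C assume sep: "separates V E1 C A B" "A \<subseteq> V" "B \<subseteq> V"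
        and C: "C \<subseteq> V" and disj: "A \<inter> B = {}" "A \<inter> C = {}" "B \<inter> C = {}"
      \<comment> \<open>No edge of \<open>E1\<close> joins \<open>A\<close> to \<open>B\<close>, so
        the endpoints are not split between them; as \<open>A\<close> and \<open>B\<close> are
        disjoint, one of them contains neither endpoint.\<close>
      have "\<not> (a \<in> A \<and> b \<in> B)" "\<not> (b \<in> A \<and> a \<in> B)"
        using separates_no_edge_across[OF sep disj] edge by blast+
      with sep disj consider "B \<subseteq> V - {a, b}" | "A \<subseteq> V - {a, b}"
        by blast
      then show "?ci A B C"
      proof cases
        case 1
        then show ?thesis
          using ci[OF sep(2) _ C] disj by blast
      next
        case 2
        then have "?ci B A C"
          using ci[OF sep(3) _ C] disj by (simp add: Int_commute)
        then show ?thesis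
          by (rule cond_indep_sym)
      qed
    qed
    then have "P \<in> ug_model V M E2"
      using le by (auto simp: model_le_def)
    then have ci_ab: "?ci {a} {b} (V - {a, b})"
      by (rule ug_modelD[OF _ separates_nonadjacent[OF edge(3) ab(1)]]) (use ab in auto)
    have "prob (((\<lambda>x. restrict x {a}) -` S \<inter> space P) \<inter> ((\<lambda>x. restrict x {b}) -` T \<inter> space P)) =
        prob ((\<lambda>x. restrict x {a}) -` S \<inter> space P) * prob ((\<lambda>x. restrict x {b}) -` T \<inter> space P)"
    proof (rule cond_indep_imp_prob_Int[OF ci_ab _ _ _ S T])
      fix S T U assume S: "S \<in> sets (PiM {a} M)" and T: "T \<in> sets (PiM {b} M)"
        and U: "U \<in> sets (PiM (V - {a, b}) M)"
      obtain W where W: "W \<in> sets (PiM ({a} \<union> {b}) M)"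
        "prod_emb V M {a} S \<inter> prod_emb V M {b} T = prod_emb V M ({a} \<union> {b}) W"
        using join[OF _ _ S T] ab by auto
      have "prob (prod_emb V M (V - {a, b}) U \<inter> (prod_emb V M {a} S \<inter> prod_emb V M {b} T)) =
          prob (prod_emb V M (V - {a, b}) U) * prob (prod_emb V M {a} S \<inter> prod_emb V M {b} T)"
        unfolding W(2) using ab U W(1) by (intro indep) auto
      then show "prob (((\<lambda>x. restrict x {a}) -` S \<inter> space P) \<inter> ((\<lambda>x. restrict x {b}) -` T \<inter> space P) \<inter>
            ((\<lambda>x. restrict x (V - {a, b})) -` U \<inter> space P)) =
          prob (((\<lambda>x. restrict x {a}) -` S \<inter> space P) \<inter> ((\<lambda>x. restrict x {b}) -` T \<inter> space P)) *
          prob ((\<lambda>x. restrict x (V - {a, b})) -` U \<inter> space P)"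
        unfolding emb by (simp only: Int_ac mult.commute)
    qed (use ab in \<open>auto intro: meas\<close>)
    then show False
      using dep by (simp add: emb)
  qed
qed

section \<open>Distances\<close>

text \<open>For \<open>e\<close> in \<open>y - x\<close> the set \<open>insert e x\<close> lies
  between \<open>x\<close> and \<open>y\<close>, so a cover must equal it. Conversely, nothing fits
  strictly between \<open>x\<close> and \<open>insert e x\<close>.\<close>

lemma covered_by_Pow_iff:
  assumes le: "\<And>x y. \<lbrakk>x \<subseteq> U; y \<subseteq> U\<rbrakk> \<Longrightarrow> le x y \<longleftrightarrow> x \<subseteq> y"
    and xy: "x \<subseteq> U" "y \<subseteq> U"
  shows "covered_by (Pow U) le x y \<longleftrightarrow> (\<exists>e. e \<notin> x \<and> y = insert e x)"
proof
  assume cov: "covered_by (Pow U) le x y"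
  then have "x \<subset> y"
    using le xy by (auto simp: covered_by_def strictly_below_def)
  then obtain e where e: "e \<in> y" "e \<notin> x"
    by blast
  have "insert e x \<subseteq> U"
    using xy e by auto
  then have "\<not> (strictly_below le x (insert e x) \<and> strictly_below le (insert e x) y)"
    using cov by (auto simp: covered_by_def)
  moreover have "le x (insert e x)" "le (insert e x) y"
    using le xy \<open>insert e x \<subseteq> U\<close> \<open>x \<subset> y\<close> e by auto
  ultimately have "y = insert e x"
    using e by (auto simp: strictly_below_def)
  with e show "\<exists>e. e \<notin> x \<and> y = insert e x"
    by blast
next
  assume "\<exists>e. e \<notin> x \<and> y = insert e x"
  then show "covered_by (Pow U) le x y"
    using le xy by (auto simp: covered_by_def strictly_below_def)
qed

text \<open>A covering step in either direction toggles one element. Hence every connecting sequence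
  needs one step per element of the difference, and toggling these elements one by one attains the
  bound.\<close>

lemma poset_dist_Pow:
  assumes "finite U" and le: "\<And>x y. \<lbrakk>x \<subseteq> U; y \<subseteq> U\<rbrakk> \<Longrightarrow> le x y \<longleftrightarrow> x \<subseteq> y"
    and s: "s \<subseteq> U" and t: "t \<subseteq> U"
  shows "poset_dist (Pow U) le s t = enat (card (sym_diff s t))"
proof -
  let ?adj = "\<lambda>x y. covered_by (Pow U) le x y \<or> covered_by (Pow U) le y x"
  \<comment> \<open>The endpoints are parameters so that the induction for the upper bound can move
    the starting point.\<close>
  define chain where "chain s t d g \<longleftrightarrow> g 0 = s \<and> g d = t \<and> (\<forall>i\<le>d. g i \<in> Pow U) \<and>
    (\<forall>i<d. ?adj (g i) (g (Suc i)))" for s t and d :: nat and g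
  have cov: "covered_by (Pow U) le x y \<longleftrightarrow> (\<exists>e. e \<notin> x \<and> y = insert e x)"
    if "x \<subseteq> U" "y \<subseteq> U" for x y
    using le that by (rule covered_by_Pow_iff)
  have adj: "?adj x y \<longleftrightarrow> (\<exists>e. y = sym_diff x {e})" if xy: "x \<subseteq> U" "y \<subseteq> U" for x y
  proof
    assume "?adj x y"
    then obtain e where "e \<notin> x \<and> y = insert e x \<or> e \<notin> y \<and> x = insert e y"
      unfolding cov[OF xy] cov[OF xy(2,1)] by blast
    then have "y = sym_diff x {e}"
      by auto
    then show "\<exists>e. y = sym_diff x {e}" ..
  next
    assume "\<exists>e. y = sym_diff x {e}"
    then obtain e where e: "y = sym_diff x {e}" ..
    then have "e \<notin> x \<and> y = insert e x \<or> e \<notin> y \<and> x = insert e y"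
      by auto
    then show "?adj x y"
      unfolding cov[OF xy] cov[OF xy(2,1)] by blast
  qed
  have lower: "card (sym_diff s t) \<le> d" if "chain s t d g" for d g
  proof -
    have g: "g 0 = s" "g d = t" "\<And>i. i \<le> d \<Longrightarrow> g i \<subseteq> U" "\<And>i. i < d \<Longrightarrow> ?adj (g i) (g (Suc i))"
      using that by (auto simp: chain_def)
    \<comment> \<open>Each toggle adds at most one element to the difference from the start.\<close>
    have "card (sym_diff s (g i)) \<le> i" if "i \<le> d" for i
      using that
    proof (induction i)
      case 0
      then show ?case
        using g by simp
    next
      case (Suc i)
      then have gi: "g i \<subseteq> U" "g (Suc i) \<subseteq> U" "?adj (g i) (g (Suc i))"
        using g by auto
      then obtain e where "g (Suc i) = sym_diff (g i) {e}"
        unfolding adj[OF gi(1,2)] by blast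
      then have "sym_diff s (g (Suc i)) \<subseteq> insert e (sym_diff s (g i))"
        by auto
      moreover have fin: "finite (sym_diff s (g i))"
        using g(3)[of i] Suc.prems \<open>finite U\<close> s by (auto intro: finite_subset)
      ultimately have "card (sym_diff s (g (Suc i))) \<le> card (insert e (sym_diff s (g i)))"
        by (intro card_mono) auto
      also have "\<dots> \<le> Suc (card (sym_diff s (g i)))"
        using fin by (simp add: card_insert_if)
      finally show ?case
        using Suc by simp
    qed
    then show ?thesis
      using g by auto
  qed
  have upper: "\<exists>g. chain s t n g" if "s \<subseteq> U" "card (sym_diff s t) = n" for n s
    using that
  proof (induction n arbitrary: s)
    case 0
    then have "s = t"
      using \<open>finite U\<close> t by (auto simp: finite_subset card_eq_0_iff)
    then show ?case
      using 0 by (intro exI[of _ "\<lambda>_. s"]) (simp add: chain_def)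
  next
    case (Suc n)
    then have "sym_diff s t \<noteq> {}"
      by (metis card.empty nat.distinct(1))
    then obtain e where e: "e \<in> sym_diff s t"
      by blast
    \<comment> \<open>Toggling a differing element brings the start one step closer to
      \<open>t\<close>; it stays inside \<open>U\<close> because \<open>e\<close> belongs to
      \<open>s\<close> or \<open>t\<close>.\<close>
    let ?s = "sym_diff s {e}"
    have "?s \<subseteq> U"
      using e Suc.prems t by auto
    have "sym_diff ?s t = sym_diff s t - {e}"
      using e by auto
    then have "card (sym_diff ?s t) = n"
      using e Suc.prems(2) by (simp only: card_Diff_singleton)
    with Suc.IH \<open>?s \<subseteq> U\<close> obtain g where g: "chain ?s t n g"
      by blast
    have "?adj s ?s"
      using adj[OF Suc.prems(1) \<open>?s \<subseteq> U\<close>] by blast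
    \<comment> \<open>\<open>case_nat s g\<close> prepends \<open>s\<close> to the sequence,
      shifting the indices of \<open>g\<close> by one.\<close>
    then have "chain s t (Suc n) (case_nat s g)"
      using g Suc.prems by (auto simp: chain_def split: nat.split)
    then show ?case
      by blast
  qed
  have dist: "poset_dist (Pow U) le s t = Inf {enat d |d. \<exists>g. chain s t d g}"
    unfolding poset_dist_def chain_def by simp
  show ?thesis
    unfolding dist
  proof (rule antisym)
    show "Inf {enat d |d. \<exists>g. chain s t d g} \<le> enat (card (sym_diff s t))"
      using upper[OF s refl] by (intro Inf_lower) blast
    show "enat (card (sym_diff s t)) \<le> Inf {enat d |d. \<exists>g. chain s t d g}"
      using lower by (intro Inf_greatest) auto
  qed
qed

section \<open>Structural Hamming distance as a count of differing edges\<close>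

lemma card_sym_diff_eq_SHD1:
  fixes V :: "'v::linorder set"
  assumes "finite V" "E1 \<in> ugraphs V" "E2 \<in> ugraphs V"
  shows "card (sym_diff E1 E2) = SHD1 V (adj_matrix E1) (adj_matrix E2)"
proof -
  let ?I = "{(i, j). i \<in> V \<and> j \<in> V \<and> i < j}"
  let ?D = "{(i, j) \<in> ?I. {i, j} \<in> sym_diff E1 E2}"
  have "finite ?I"
    by (rule finite_subset[of _ "V \<times> V"]) (use assms in auto)
  \<comment> \<open>Every two-element set has exactly one increasing listing, so differing edges
    correspond to the index pairs with \<open>i < j\<close> at which the graphs differ.\<close>
  have "bij_betw (\<lambda>(i, j). {i, j}) ?D (sym_diff E1 E2)"
    unfolding bij_betw_def
  proof
    show "inj_on (\<lambda>(i, j). {i, j}) ?D"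
      by (auto simp: inj_on_def doubleton_eq_iff)
    have "\<exists>i j. e = {i, j} \<and> i \<in> V \<and> j \<in> V \<and> i < j" if "e \<in> sym_diff E1 E2" for e
    proof -
      have "e \<subseteq> V" "card e = 2"
        using that assms by (auto simp: ugraphs_def)
      then obtain i j where "e = {i, j}" "i \<noteq> j" "i \<in> V" "j \<in> V"
        by (auto simp: card_2_iff)
      then show ?thesis
        by (cases "i < j") (auto simp: insert_commute not_less le_less)
    qed
    then show "(\<lambda>(i, j). {i, j}) ` ?D = sym_diff E1 E2"
      by (fastforce simp: image_iff)
  qed
  then have "card (sym_diff E1 E2) = card ?D"
    by (simp add: bij_betw_same_card)
  also have "\<dots> = (\<Sum>x\<in>?I. of_bool (x \<in> ?D))"
    using \<open>finite ?I\<close> by (simp only: sum_of_bool_eq of_nat_id) (intro arg_cong[of _ _ card], auto)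
  \<comment> \<open>The adjacency matrix is symmetric because \<open>{i, j} = {j, i}\<close>, so
    both disjuncts in \<open>SHD1\<close> express the same condition.\<close>
  also have "\<dots> = SHD1 V (adj_matrix E1) (adj_matrix E2)"
    unfolding SHD1_def by (intro sum.cong refl) (auto simp: adj_matrix_def insert_commute split: if_splits)
  finally show ?thesis .
qed

theorem corollary2:
  fixes V :: "'v::linorder set"
    and M :: "'v \<Rightarrow> 'a measure"
    and E1 E2 :: "'v set set"
  assumes "finite V"
    and "\<And>v. v \<in> V \<Longrightarrow> sigma_finite_measure (M v)"
    and "\<And>v. v \<in> V \<Longrightarrow> nondegenerate (M v)"
    and "E1 \<in> ugraphs V"
    and "E2 \<in> ugraphs V"
  shows "poset_dist (ugraphs V) (model_le V M) E1 E2 = enat (card (sym_diff E1 E2)) \<and>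
    card (sym_diff E1 E2) = SHD1 V (adj_matrix E1) (adj_matrix E2)"
proof
  let ?U = "{e. e \<subseteq> V \<and> card e = 2}"
  \<comment> \<open>The graphs form the full power set of the possible edges \<open>?U\<close>, so
    the distance formula for Boolean lattices applies.\<close>
  have ugraphs: "ugraphs V = Pow ?U"
    by (auto simp: ugraphs_def)
  have "finite ?U"
    using \<open>finite V\<close> by (auto intro: finite_subset[of _ "Pow V"])
  moreover have "model_le V M x y \<longleftrightarrow> x \<subseteq> y" if "x \<subseteq> ?U" for x y
    using that assms by (intro model_le_iff_subset) (auto simp: ugraphs)
  ultimately show "poset_dist (ugraphs V) (model_le V M) E1 E2 = enat (card (sym_diff E1 E2))"
    unfolding ugraphs using assms(4,5) by (intro poset_dist_Pow) (auto simp: ugraphs)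
  show "card (sym_diff E1 E2) = SHD1 V (adj_matrix E1) (adj_matrix E2)"
    using assms by (intro card_sym_diff_eq_SHD1)
qed

end
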